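(* Let $k$ be an algebraically closed field of characteristic $p>0$ and let $\mathfrak g$ be a classical Lie algebra over $k$ (type $A$, $B$, $C$ or $D$), realized by matrices as in the context. For every $r\ge 1$ and every prime $p\ge 2$ (not necessarily good for $\mathfrak g$), $$\dim C_r(\mathfrak u_1)\ \ge\ r\dim\mathfrak w .$$
   Context: Let $J_\ell$ be the $\ell\times\ell$ matrix with $1$'s on the anti-diagonal and $0$'s elsewhere, and for an $\ell\times\ell$ matrix $m$ let $m^J$ be its reflection over the anti-diagonal. Realize $\mathfrak g$ inside $\mathfrak{gl}_n$: $\mathfrak{sl}_n$ is the traceless matrices; $\mathfrak{sp}_{2\ell}$, $\mathfrak{so}_{2\ell}$, $\mathfrak{so}_{2\ell+1}$ are the matrices $X$ with $X^tS+SX=0$, consisting of the block matrices $\begin{pmatrix} m_{11} & m_{12} \\ m_{21} & m_{22} \end{pmatrix}$ (with a middle row and column, having zero central entry, in the odd orthogonal case) with respect to $S=\begin{pmatrix} 0 & J_\ell \\ -J_\ell & 0 \end{pmatrix}$, $\begin{pmatrix} 0 & J_\ell \\ J_\ell & 0 \end{pmatrix}$, $\begin{pmatrix} 0 & 0 & J_\ell \\ 0 & 1 & 0 \\ J_\ell & 0 & 0 \end{pmatrix}$ respectively, where $m_{12},m_{21}$ are symmetric (for $\mathfrak{sp}_{2\ell}$) or skew-symmetric (for $\mathfrak{so}$) over the anti-diagonal. Let $\mathfrak u$ be the strictly upper triangular matrices in $\mathfrak g$, $\mathcal N_1=\{x\in\mathfrak g: x^{[p]}=0\}$ where $x^{[p]}$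 is the $p$-th matrix power, and $\mathfrak u_1=\mathcal N_1\cap\mathfrak u$. $\mathfrak w\subseteq\mathfrak u$ is the space of matrices whose only nonzero block is an upper-right corner block $m$, where: for $\mathfrak{sl}_{2\ell}$, $m$ is any $\ell\times\ell$ matrix; for $\mathfrak{sl}_{2\ell+1}$, $m$ is any $\ell\times(\ell+1)$ matrix; for $\mathfrak{sp}_{2\ell}$, $m\in\mathfrak{gl}_\ell$ with $m=m^J$; for $\mathfrak{so}_{2\ell}$ and $\mathfrak{so}_{2\ell+1}$, $m\in\mathfrak{gl}_\ell$ with $m=-m^J$. For a closed subvariety $V\subseteq\mathfrak g$, $C_r(V)=\{(x_1,\dots,x_r)\in V^r:[x_i,x_j]=0,\ 1\le i\le j\le r\}$. *)

theory Defs
  imports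
    "HOL-Analysis.Abstract_Topology"
    "HOL-Library.Extended_Nat"
    "HOL-Computational_Algebra.Computational_Algebra"
    "Jordan_Normal_Form.VS_Connect"
begin

section \<open>Krull dimension of a topological space\<close>

definition irreducible_in :: "'a topology \<Rightarrow> 'a set \<Rightarrow> bool" where
  "irreducible_in T Z \<longleftrightarrow> Z \<noteq> {} \<and> Z \<subseteq> topspace T \<and>
     (\<forall>C D. closedin T C \<longrightarrow> closedin T D \<longrightarrow> Z \<subseteq> C \<union> D \<longrightarrow> Z \<subseteq> C \<or> Z \<subseteq> D)"

definition krull_dim :: "'a topology \<Rightarrow> enat" where
  "krull_dim T = Sup {enat d | d. \<exists>Z. (\<forall>i\<le>d. closedin T (Z i) \<and> irreducible_in T (Z i))
                                     \<and> (\<forall>i<d. Z i \<subset> Z (Suc i))}"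

section \<open>The Zariski topology on \<open>r\<close>-tuples of \<open>n \<times> n\<close> matrices\<close>

definition mat_tuples :: "nat \<Rightarrow> nat \<Rightarrow> 'k mat list set" where
  "mat_tuples r n = {xs. length xs = r \<and> set xs \<subseteq> carrier_mat n n}"

text \<open>The polynomials in the \<open>r n\<^sup>2\<close> matrix entries, as functions. (Only their values on
  \<^const>\<open>mat_tuples\<close> are used.)\<close>

inductive_set poly_funs :: "nat \<Rightarrow> nat \<Rightarrow> ('k::field mat list \<Rightarrow> 'k) set"
  for r n :: nat where
  const: "(\<lambda>_. c) \<in> poly_funs r n"
| coord: "t < r \<Longrightarrow> i < n \<Longrightarrow> j < n \<Longrightarrow> (\<lambda>xs. (xs ! t) $$ (i, j)) \<in> poly_funs r n"
| add: "f \<in> poly_funs r n \<Longrightarrow> g \<in> poly_funs r n \<Longrightarrow> (\<lambda>xs. f xs + g xs) \<in> poly_funs r n"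
| mult: "f \<in> poly_funs r n \<Longrightarrow> g \<in> poly_funs r n \<Longrightarrow> (\<lambda>xs. f xs * g xs) \<in> poly_funs r n"

definition zariski_open :: "nat \<Rightarrow> nat \<Rightarrow> 'k::field mat list set \<Rightarrow> bool" where
  "zariski_open r n U \<longleftrightarrow>
     (\<exists>F \<subseteq> poly_funs r n. U = mat_tuples r n - {x \<in> mat_tuples r n. \<forall>f\<in>F. f x = 0})"

definition zariski :: "nat \<Rightarrow> nat \<Rightarrow> 'k::field mat list topology" where
  "zariski r n = topology (zariski_open r n)"

lemma istopology_zariski: "istopology (zariski_open r n :: 'k::field mat list set \<Rightarrow> bool)"
proof -
  let ?U = "\<lambda>F. mat_tuples r n - {x \<in> mat_tuples r n. \<forall>f\<in>F. f x = (0 :: 'k)}"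
  have openI: "zariski_open r n (?U F)" if "F \<subseteq> poly_funs r n" for F
    using that unfolding zariski_open_def by blast
  have openE: "\<exists>F. F \<subseteq> poly_funs r n \<and> U = ?U F" if "zariski_open r n U" for U
    using that unfolding zariski_open_def by blast
  show ?thesis
    unfolding istopology_def
  proof (intro conjI allI impI)
    fix S T :: "'k mat list set"
    assume S: "zariski_open r n S" and T: "zariski_open r n T"
    obtain F where F: "F \<subseteq> poly_funs r n" "S = ?U F" using openE[OF S] by blast
    obtain G where G: "G \<subseteq> poly_funs r n" "T = ?U G" using openE[OF T] by blast
    let ?H = "(\<lambda>(f, g) x. f x * g x) ` (F \<times> G)"
    have H: "?H \<subseteq> poly_funs r n" using F(1) G(1) by (auto intro!: poly_funs.mult)
    have "(\<forall>h\<in>?H. h x = 0) \<longleftrightarrow> (\<forall>f\<in>F. \<forall>g\<in>G. f x * g x = 0)" for x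
      by simp
    then have "S \<inter> T = ?U ?H" unfolding F(2) G(2) by (simp only: mult_eq_0_iff) blast
    with openI[OF H] show "zariski_open r n (S \<inter> T)" by simp
  next
    fix K :: "'k mat list set set"
    assume K: "\<forall>S\<in>K. zariski_open r n S"
    then have "\<forall>S\<in>K. \<exists>F. F \<subseteq> poly_funs r n \<and> S = ?U F" using openE by blast
    then obtain F where F: "\<forall>S\<in>K. F S \<subseteq> poly_funs r n \<and> S = ?U (F S)"
      by (rule bchoice[THEN exE])
    have H: "(\<Union>S\<in>K. F S) \<subseteq> poly_funs r n" using F by blast
    have "\<Union>K = (\<Union>S\<in>K. S)" by simp
    also have "\<dots> = (\<Union>S\<in>K. ?U (F S))" by (rule SUP_cong) (use F in auto)
    also have "\<dots> = ?U (\<Union>S\<in>K. F S)" by auto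
    finally show "zariski_open r n (\<Union>K)" using openI[OF H] by simp
  qed
qed

lemma openin_zariski: "openin (zariski r n) = zariski_open r n"
  unfolding zariski_def by (rule topology_inverse'[OF istopology_zariski])

lemma topspace_zariski: "topspace (zariski r n) = (mat_tuples r n :: 'k::field mat list set)"
proof -
  have "zariski_open r n (mat_tuples r n :: 'k mat list set)"
    unfolding zariski_open_def
  proof (intro exI conjI)
    show "{\<lambda>_. 1} \<subseteq> poly_funs r n" by (simp add: poly_funs.const)
  qed simp
  moreover have "U \<subseteq> mat_tuples r n" if "zariski_open r n U" for U :: "'k mat list set"
    using that unfolding zariski_open_def by (elim exE conjE) simp
  ultimately show ?thesis unfolding topspace_def openin_zariski by blast
qed

lemma closedin_zariski:
  fixes Z :: "'k::field mat list set"
  shows "closedin (zariski r n) Z \<longleftrightarrow>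
     (\<exists>F \<subseteq> poly_funs r n. Z = {x \<in> mat_tuples r n. \<forall>f\<in>F. f x = 0})"
proof -
  have pull: "(Q \<and> (\<exists>F \<subseteq> P. R F)) \<longleftrightarrow> (\<exists>F \<subseteq> P. Q \<and> R F)"
    for Q R and P :: "('k mat list \<Rightarrow> 'k) set"
    by blast
  have "closedin (zariski r n) Z \<longleftrightarrow> (\<exists>F \<subseteq> poly_funs r n. Z \<subseteq> mat_tuples r n \<and>
      mat_tuples r n - Z = mat_tuples r n - {x \<in> mat_tuples r n. \<forall>f\<in>F. f x = 0})"
    unfolding closedin_def topspace_zariski openin_zariski zariski_open_def by (rule pull)
  moreover have "Z \<subseteq> A \<and> A - Z = A - {x \<in> A. P x} \<longleftrightarrow> Z = {x \<in> A. P x}" for A P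
    by fast
  ultimately show ?thesis by simp
qed

section \<open>Classical Lie algebras as matrix Lie algebras\<close>

text \<open>The argument of \<open>SL\<close> is the matrix size; for the other families it is the rank.\<close>

datatype classical = SL nat | SP nat | SO_even nat | SO_odd nat

fun proper :: "classical \<Rightarrow> bool" where
  "proper (SL n) \<longleftrightarrow> 2 \<le> n"
| "proper (SP l) \<longleftrightarrow> 1 \<le> l"
| "proper (SO_even l) \<longleftrightarrow> 1 \<le> l"
| "proper (SO_odd l) \<longleftrightarrow> 1 \<le> l"

fun msize :: "classical \<Rightarrow> nat" where
  "msize (SL n) = n"
| "msize (SP l) = 2 * l"
| "msize (SO_even l) = 2 * l"
| "msize (SO_odd l) = 2 * l + 1"

definition antidiag :: "nat \<Rightarrow> 'k::{zero,one} mat" where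
  "antidiag l = mat l l (\<lambda>(i, j). if i + j + 1 = l then 1 else 0)"

text \<open>Reflection of a square matrix over its anti-diagonal.\<close>

definition reflect :: "'k mat \<Rightarrow> 'k mat" where
  "reflect m = mat (dim_row m) (dim_row m)
     (\<lambda>(i, j). m $$ (dim_row m - 1 - j, dim_row m - 1 - i))"

definition sp_form :: "nat \<Rightarrow> 'k::comm_ring_1 mat" where
  "sp_form l = four_block_mat (0\<^sub>m l l) (antidiag l) (- antidiag l) (0\<^sub>m l l)"

definition so_even_form :: "nat \<Rightarrow> 'k::comm_ring_1 mat" where
  "so_even_form l = four_block_mat (0\<^sub>m l l) (antidiag l) (antidiag l) (0\<^sub>m l l)"

text \<open>The \<open>3 \<times> 3\<close> block matrix with rows \<open>(0, 0, J)\<close>, \<open>(0, 1, 0)\<close>, \<open>(J, 0, 0)\<close>: the last two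
  block rows, restricted to the first two block columns, form the lower left block.\<close>

definition so_odd_form :: "nat \<Rightarrow> 'k::comm_ring_1 mat" where
  "so_odd_form l = four_block_mat
     (0\<^sub>m l (l + 1)) (antidiag l)
     (four_block_mat (0\<^sub>m 1 l) (1\<^sub>m 1) (antidiag l) (0\<^sub>m l 1)) (0\<^sub>m (l + 1) l)"

definition preserving :: "nat \<Rightarrow> 'k::comm_ring_1 mat \<Rightarrow> 'k mat set" where
  "preserving n S = {X \<in> carrier_mat n n. transpose_mat X * S + S * X = 0\<^sub>m n n}"

text \<open>In the odd orthogonal case the vanishing of the central entry follows from the equation
  defining \<^const>\<open>preserving\<close> unless the characteristic is 2, where it is a separate condition.\<close>

fun lie_alg :: "classical \<Rightarrow> 'k::comm_ring_1 mat set" where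
  "lie_alg (SL n) = {X \<in> carrier_mat n n. (\<Sum>i<n. X $$ (i, i)) = 0}"
| "lie_alg (SP l) = preserving (2 * l) (sp_form l)"
| "lie_alg (SO_even l) = preserving (2 * l) (so_even_form l)"
| "lie_alg (SO_odd l) = {X \<in> preserving (2 * l + 1) (so_odd_form l). X $$ (l, l) = 0}"

definition nilrad :: "classical \<Rightarrow> 'k::comm_ring_1 mat set" where
  "nilrad L = {X \<in> lie_alg L. \<forall>i<msize L. \<forall>j\<le>i. X $$ (i, j) = 0}"

definition restricted_nullcone :: "nat \<Rightarrow> classical \<Rightarrow> 'k::comm_ring_1 mat set" where
  "restricted_nullcone p L = {X \<in> lie_alg L. X ^\<^sub>m p = 0\<^sub>m (msize L) (msize L)}"

definition nilrad1 :: "nat \<Rightarrow> classical \<Rightarrow> 'k::comm_ring_1 mat set" where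
  "nilrad1 p L = restricted_nullcone p L \<inter> nilrad L"

text \<open>The block in the upper right corner has \<open>l\<close> rows and \<open>l\<close> columns, except for \<open>SL n\<close> with
  \<open>n = 2 l + 1\<close>, where it has \<open>l\<close> rows and \<open>l + 1\<close> columns.\<close>

definition corner :: "nat \<Rightarrow> 'k::zero mat \<Rightarrow> 'k mat" where
  "corner n m = four_block_mat
     (0\<^sub>m (dim_row m) (n - dim_col m)) m
     (0\<^sub>m (n - dim_row m) (n - dim_col m)) (0\<^sub>m (n - dim_row m) (dim_col m))"

fun corner_blocks :: "classical \<Rightarrow> 'k::comm_ring_1 mat set" where
  "corner_blocks (SL n) = carrier_mat (n div 2) (n - n div 2)"
| "corner_blocks (SP l) = {m \<in> carrier_mat l l. m = reflect m}"
| "corner_blocks (SO_even l) = {m \<in> carrier_mat l l. m = - reflect m}"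
| "corner_blocks (SO_odd l) = {m \<in> carrier_mat l l. m = - reflect m}"

definition corner_space :: "classical \<Rightarrow> 'k::comm_ring_1 mat set" where
  "corner_space L = corner (msize L) ` corner_blocks L"

section \<open>Commuting varieties and dimensions\<close>

definition commuting_variety :: "nat \<Rightarrow> 'k::comm_ring_1 mat set \<Rightarrow> 'k mat list set" where
  "commuting_variety r V = {xs. length xs = r \<and> set xs \<subseteq> V \<and>
     (\<forall>j<r. \<forall>i\<le>j. xs ! i * xs ! j - xs ! j * xs ! i = 0\<^sub>m (dim_row (xs ! i)) (dim_row (xs ! i)))}"

definition variety_dim :: "nat \<Rightarrow> nat \<Rightarrow> 'k::field mat list set \<Rightarrow> enat" where
  "variety_dim r n V = krull_dim (subtopology (zariski r n) V)"

definition subspace_dim :: "nat \<Rightarrow> 'k::field mat set \<Rightarrow> nat" where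
  "subspace_dim n W = vectorspace.dim class_ring (module_mat TYPE('k) n n \<lparr>carrier := W\<rparr>)"

end

theory Submission
  imports Defs
begin

text \<open>
  Two matrices supported on an upper right corner that avoids the diagonal have product zero: the
  columns met by the first are rows that the second leaves empty. So all elements of the corner
  space \<open>\<ww>\<close> commute with each other and square to zero, hence have vanishing \<open>p\<close>-th power for
  every prime \<open>p\<close>; and the reflection rule imposed on the corner block is exactly what makes such a
  matrix preserve the bilinear form. Thus \<open>\<ww>\<^sup>r \<subseteq> C\<^sub>r(\<uu>\<^sub>1)\<close>, and it remains to find a chain of
  irreducible closed sets of length \<open>r \<cdot> dim \<ww>\<close> inside the linear space \<open>\<ww>\<^sup>r\<close>.

  Linear subspaces serve for this. One of them is irreducible because any two of its points
  lie on a line inside it, on which a polynomial function becomes a polynomial in one variable,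
  and the field is infinite (\<open>irreducible_in_subtopology_zariski\<close>). A flag of subspaces arises by
  requiring the first \<open>u\<close> matrix entries to vanish, for \<open>u = 0, 1, \<dots>\<close>; these are closed in
  \<open>\<ww>\<^sup>r\<close> by construction, so no basis or complement has to be chosen. The flag of \<open>\<ww>\<close> itself drops
  at the pivot positions of an echelon form; choosing one matrix per pivot gives a spanning set,
  so there are at least \<open>dim \<ww>\<close> pivots (\<open>subspace_dim_le_card_pivots\<close>), and the flag of
  \<open>\<ww>\<^sup>r\<close> repeats these drops \<open>r\<close> times (\<open>variety_dim_ge_subspace_tuples\<close>).

  To treat the four families at once, each corner space is written as the solution set of linear
  equations \<open>X\<^bsub>ij\<^esub> = e\<^bsub>ij\<^esub> X\<^bsub>\<sigma>(i,j)\<^esub>\<close>, from which closedness and linearity are read off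
  uniformly.
\<close>

section \<open>Linear sets of matrix tuples are irreducible\<close>

lemma infinite_alg_closed_field: "infinite (UNIV :: 'k::alg_closed_field set)"
proof
  assume fin: "finite (UNIV :: 'k set)"
  define q :: "'k poly" where "q = (\<Prod>a\<in>UNIV. [:- a, 1:]) + 1"
  \<comment> \<open>The product vanishes at every element of a finite field, so \<open>q\<close> would have no root.\<close>
  have eq1: "poly q x = 1" for x
    unfolding q_def by (simp add: poly_prod prod_zero_iff[OF fin])
  have "degree (\<Prod>a\<in>(UNIV :: 'k set). [:- a, 1:]) = card (UNIV :: 'k set)"
    by (subst degree_prod_sum_eq) auto
  moreover have "card (UNIV :: 'k set) > 0" using fin by (simp add: finite_UNIV_card_ge_0)
  ultimately have "degree q > 0"
    unfolding q_def by (subst degree_add_eq_left) auto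
  then obtain x where "poly q x = 0" using alg_closed_imp_poly_has_root by blast
  with eq1 show False by simp
qed

definition line :: "'k::field mat list \<Rightarrow> 'k mat list \<Rightarrow> 'k \<Rightarrow> 'k mat list" where
  "line xs ys c = map2 (\<lambda>A B. A + c \<cdot>\<^sub>m (B - A)) xs ys"

lemma line_nth_index:
  assumes "xs \<in> mat_tuples r n" "ys \<in> mat_tuples r n" "t < r" "i < n" "j < n"
  shows "(line xs ys c ! t) $$ (i, j) = xs ! t $$ (i, j) + c * (ys ! t $$ (i, j) - xs ! t $$ (i, j))"
proof -
  have "xs ! t \<in> carrier_mat n n" "ys ! t \<in> carrier_mat n n"
    using assms by (auto simp: mat_tuples_def)
  then show ?thesis using assms by (auto simp: line_def mat_tuples_def)
qed

lemma line_endpoints: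
  assumes "xs \<in> mat_tuples r n" "ys \<in> mat_tuples r n"
  shows "line xs ys 0 = xs" "line xs ys 1 = ys"
proof -
  have *: "length xs = r" "length ys = r"
    "t < r \<Longrightarrow> xs ! t \<in> carrier_mat n n" "t < r \<Longrightarrow> ys ! t \<in> carrier_mat n n" for t
    using assms by (auto simp: mat_tuples_def)
  have "line xs ys 0 ! t = xs ! t" "line xs ys 1 ! t = ys ! t" if "t < r" for t
    using *(3,4)[OF that] *(1,2) that by (auto simp: line_def intro!: eq_matI)
  then show "line xs ys 0 = xs" "line xs ys 1 = ys"
    using * by (auto intro!: nth_equalityI simp: line_def)
qed

lemma poly_funs_on_line:
  assumes "f \<in> poly_funs r n" "xs \<in> mat_tuples r n" "ys \<in> mat_tuples r n"
  shows "\<exists>q. \<forall>c. f (line xs ys c) = poly q c"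
  using assms(1)
proof induction
  case (const a)
  have "\<forall>c. a = poly [:a:] c" by simp
  then show ?case by blast
next
  case (coord t i j)
  let ?a = "xs ! t $$ (i, j)" and ?b = "ys ! t $$ (i, j)"
  have "\<forall>c. (line xs ys c ! t) $$ (i, j) = poly [:?a, ?b - ?a:] c"
    using line_nth_index[OF assms(2,3) coord] by simp
  then show ?case by blast
next
  case (add f g)
  then show ?case by (metis poly_add)
next
  case (mult f g)
  then show ?case by (metis poly_mult)
qed

text \<open>If \<open>Z\<close> is covered by two closed sets but lies in neither, some \<open>f\<close> vanishing on the first is
  nonzero at a point \<open>a\<close> of \<open>Z\<close>, and some \<open>g\<close> vanishing on the second is nonzero at a point \<open>b\<close>. Along
  the line through \<open>a\<close> and \<open>b\<close> the product \<open>f g\<close> is a nonzero polynomial in the parameter, so it has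
  a non-root, and this gives a point of \<open>Z\<close> outside both sets.\<close>

lemma irreducible_in_subtopology_zariski:
  fixes Z :: "'k::field mat list set"
  assumes inf: "infinite (UNIV :: 'k set)"
    and ne: "Z \<noteq> {}" and ZV: "Z \<subseteq> V" and Zt: "Z \<subseteq> mat_tuples r n"
    and line: "\<And>xs ys c. xs \<in> Z \<Longrightarrow> ys \<in> Z \<Longrightarrow> line xs ys c \<in> Z"
  shows "irreducible_in (subtopology (zariski r n) V) Z"
  unfolding irreducible_in_def
proof (intro conjI allI impI)
  show "Z \<noteq> {}" by fact
  show "Z \<subseteq> topspace (subtopology (zariski r n) V)"
    using ZV Zt by (auto simp: topspace_subtopology topspace_zariski)
  fix C D
  assume "closedin (subtopology (zariski r n) V) C" "closedin (subtopology (zariski r n) V) D"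
    and cover: "Z \<subseteq> C \<union> D"
  then obtain C' D' where
    C': "closedin (zariski r n) C'" "C = C' \<inter> V" and D': "closedin (zariski r n) D'" "D = D' \<inter> V"
    by (auto simp: closedin_subtopology)
  obtain F where F: "F \<subseteq> poly_funs r n" "C' = {x \<in> mat_tuples r n. \<forall>f\<in>F. f x = 0}"
    using C'(1) unfolding closedin_zariski by blast
  obtain G where G: "G \<subseteq> poly_funs r n" "D' = {x \<in> mat_tuples r n. \<forall>f\<in>G. f x = 0}"
    using D'(1) unfolding closedin_zariski by blast
  show "Z \<subseteq> C \<or> Z \<subseteq> D"
  proof (rule ccontr)
    assume "\<not> (Z \<subseteq> C \<or> Z \<subseteq> D)"
    then obtain a b where a: "a \<in> Z" "a \<notin> C" and b: "b \<in> Z" "b \<notin> D" by blast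
    have mem: "a \<in> mat_tuples r n" "b \<in> mat_tuples r n" using a b Zt by auto
    obtain f where f: "f \<in> F" "f a \<noteq> 0" using a ZV mem C'(2) F(2) by auto
    obtain g where g: "g \<in> G" "g b \<noteq> 0" using b ZV mem D'(2) G(2) by auto
    obtain pf where pf: "\<And>c. f (line a b c) = poly pf c"
      using poly_funs_on_line[OF _ mem] f F(1) by blast
    obtain pg where pg: "\<And>c. g (line a b c) = poly pg c"
      using poly_funs_on_line[OF _ mem] g G(1) by blast
    have "poly pf 0 \<noteq> 0" "poly pg 1 \<noteq> 0"
      using f g pf[of 0] pg[of 1] line_endpoints[OF mem] by auto
    then have "pf * pg \<noteq> 0" by auto
    then have "finite {c. poly (pf * pg) c = 0}" by (rule poly_roots_finite)
    then obtain c where c: "poly (pf * pg) c \<noteq> 0"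
      using inf by (metis (mono_tags, lifting) UNIV_eq_I mem_Collect_eq)
    have "line a b c \<in> C' \<union> D'" using line[OF a(1) b(1)] cover C'(2) D'(2) by blast
    then have "f (line a b c) = 0 \<or> g (line a b c) = 0" using f(1) g(1) F(2) G(2) by auto
    with c show False by (simp add: pf pg)
  qed
qed

section \<open>Chains and dimension\<close>

text \<open>A flag cut out by successive equations may be stationary for many steps; this lets such a flag
  be used as it is, by counting only the steps at which it changes. The chain is built upwards from
  the smallest set \<open>Z M\<close>, and \<open>d u\<close> is the number of changes met on the way up to \<open>Z u\<close>.\<close>

lemma krull_dim_ge_strict_steps:
  assumes irr: "\<And>u. u \<le> M \<Longrightarrow> closedin T (Z u) \<and> irreducible_in T (Z u)"
    and dec: "\<And>u. u < M \<Longrightarrow> Z (Suc u) \<subseteq> Z u"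
  shows "enat (card {u. u < M \<and> Z (Suc u) \<noteq> Z u}) \<le> krull_dim T"
proof -
  define d where "d u = card {v. u \<le> v \<and> v < M \<and> Z (Suc v) \<noteq> Z v}" for u
  have chain: "\<exists>Y. (\<forall>i\<le>d u. closedin T (Y i) \<and> irreducible_in T (Y i)) \<and>
      (\<forall>i<d u. Y i \<subset> Y (Suc i)) \<and> Y (d u) = Z u" if "u \<le> M" for u
    using that
  proof (induction rule: inc_induct)
    case base
    have "d M = 0" by (simp add: d_def)
    then show ?case using irr[of M] by (intro exI[of _ "\<lambda>_. Z M"]) simp
  next
    case (step u)
    then obtain Y where Y: "\<forall>i\<le>d (Suc u). closedin T (Y i) \<and> irreducible_in T (Y i)"
      "\<forall>i<d (Suc u). Y i \<subset> Y (Suc i)" "Y (d (Suc u)) = Z (Suc u)" by blast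
    show ?case
    proof (cases "Z (Suc u) = Z u")
      case True
      then have "{v. u \<le> v \<and> v < M \<and> Z (Suc v) \<noteq> Z v} =
          {v. Suc u \<le> v \<and> v < M \<and> Z (Suc v) \<noteq> Z v}"
        by (auto simp: Suc_le_eq le_less)
      then have "d u = d (Suc u)" by (simp add: d_def)
      then show ?thesis using Y True by auto
    next
      case False
      then have "{v. u \<le> v \<and> v < M \<and> Z (Suc v) \<noteq> Z v} =
          insert u {v. Suc u \<le> v \<and> v < M \<and> Z (Suc v) \<noteq> Z v}"
        using step by (auto simp: Suc_le_eq le_less)
      then have d: "d u = Suc (d (Suc u))" by (simp add: d_def)
      have "Z (Suc u) \<subset> Z u" using dec[of u] False step by auto
      then show ?thesis
        using Y irr[of u] step
        by (intro exI[of _ "Y(d u := Z u)"]) (auto simp: d less_Suc_eq le_Suc_eq)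
    qed
  qed
  have "d 0 = card {u. u < M \<and> Z (Suc u) \<noteq> Z u}" by (simp add: d_def)
  then show ?thesis
    using chain[of 0] unfolding krull_dim_def by (intro Sup_upper) auto
qed

section \<open>Flags of subspaces cut out by matrix entries\<close>

text \<open>Matrix positions are numbered row by row, so that a single number measures the progress of
  the flag.\<close>

definition entry :: "nat \<Rightarrow> 'k mat \<Rightarrow> nat \<Rightarrow> 'k" where
  "entry n X q = X $$ (q div n, q mod n)"

definition flag :: "nat \<Rightarrow> 'k::zero mat set \<Rightarrow> nat \<Rightarrow> 'k mat set" where
  "flag n W s = {X \<in> W. \<forall>q<s. entry n X q = 0}"

text \<open>The positions of the leading entries in an echelon form of \<open>W\<close>.\<close>

definition pivots :: "nat \<Rightarrow> 'k::zero mat set \<Rightarrow> nat set" where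
  "pivots n W = {q. q < n * n \<and> (\<exists>X\<in>flag n W q. entry n X q \<noteq> 0)}"

lemma pivots_less: "q \<in> pivots n W \<Longrightarrow> q < n * n"
  by (simp add: pivots_def)

lemma entry_bounds: "q < n * n \<Longrightarrow> q div n < n \<and> q mod n < (n::nat)"
  by (metis less_mult_imp_div_less mod_less_divisor mult_0_right not_gr_zero not_less_zero)

lemma entry_add:
  "q < n * n \<Longrightarrow> X \<in> carrier_mat n n \<Longrightarrow> Y \<in> carrier_mat n n \<Longrightarrow>
    entry n (X + Y) q = entry n X q + entry n Y q"
  using entry_bounds[of q n] by (simp add: entry_def)

lemma entry_smult:
  "q < n * n \<Longrightarrow> X \<in> carrier_mat n n \<Longrightarrow> entry n (c \<cdot>\<^sub>m X) q = c * entry n X q"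
  using entry_bounds[of q n] by (simp add: entry_def)

lemma entry_zero: "q < n * n \<Longrightarrow> entry n (0\<^sub>m n n) q = 0"
  using entry_bounds[of q n] by (simp add: entry_def)

lemma eq_zero_mat_if_entries:
  assumes X: "X \<in> carrier_mat n n" and 0: "\<And>q. q < n * n \<Longrightarrow> entry n X q = 0"
  shows "X = 0\<^sub>m n n"
proof (rule eq_matI)
  fix i j assume "i < dim_row (0\<^sub>m n n)" "j < dim_col (0\<^sub>m n n)"
  then have ij: "i < n" "j < n" by auto
  have "i * n + j < Suc i * n" using ij by simp
  also have "\<dots> \<le> n * n" using ij by (intro mult_le_mono1) simp
  finally have "entry n X (i * n + j) = 0" by (rule 0)
  then show "X $$ (i, j) = 0\<^sub>m n n $$ (i, j)" using ij by (simp add: entry_def)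
qed (use X in auto)

text \<open>The translation between the record operations of the module of matrices and the plain matrix
  operations.\<close>

lemma subspace_closed:
  fixes W :: "'k::field mat set"
  assumes "submodule class_ring W (module_mat TYPE('k) n n)"
  shows "W \<subseteq> carrier_mat n n" "0\<^sub>m n n \<in> W" "X \<in> W \<Longrightarrow> Y \<in> W \<Longrightarrow> X + Y \<in> W"
    "X \<in> W \<Longrightarrow> c \<cdot>\<^sub>m X \<in> W"
proof -
  interpret submodule class_ring W "module_mat TYPE('k) n n" by fact
  show "W \<subseteq> carrier_mat n n" "0\<^sub>m n n \<in> W" "X \<in> W \<Longrightarrow> Y \<in> W \<Longrightarrow> X + Y \<in> W"
    "X \<in> W \<Longrightarrow> c \<cdot>\<^sub>m X \<in> W"
    using subset m_closed zero_closed smult_closed by (simp_all add: module_mat_simps)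
qed

text \<open>Gaussian elimination: choose for each pivot \<open>q\<close> a matrix \<open>w q\<close> of \<open>W\<close> with leading position
  \<open>q\<close>. Subtracting multiples of these clears the entries of any matrix of \<open>W\<close> one position after the
  other, so the chosen matrices span \<open>W\<close>.\<close>

lemma subspace_dim_le_card_pivots:
  fixes W :: "'k::field mat set"
  assumes W: "submodule class_ring W (module_mat TYPE('k) n n)"
  shows "subspace_dim n W \<le> card (pivots n W)"
proof -
  let ?V = "module_mat TYPE('k) n n"
  note Wc = subspace_closed[OF W]
  interpret V: vectorspace class_ring ?V by (rule matrix_vs)
  have subW: "subspace class_ring W ?V" by (intro subspace.intro W V.vectorspace_axioms)
  interpret W: vectorspace class_ring "?V\<lparr>carrier := W\<rparr>" by (rule V.subspace_is_vs[OF subW])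
  have "\<forall>q\<in>pivots n W. \<exists>X. X \<in> flag n W q \<and> entry n X q \<noteq> 0" by (auto simp: pivots_def)
  then obtain w where w: "\<And>q. q \<in> pivots n W \<Longrightarrow> w q \<in> flag n W q \<and> entry n (w q) q \<noteq> 0"
    by metis
  define S where "S = w ` pivots n W"
  have finp: "finite (pivots n W)" by (rule finite_subset[of _ "{..<n*n}"]) (auto simp: pivots_def)
  have SW: "S \<subseteq> W" using w by (auto simp: S_def flag_def)
  have spm: "submodule class_ring (W.span S) (?V\<lparr>carrier := W\<rparr>)"
    using SW by (intro W.span_is_submodule) simp
  interpret sp: submodule class_ring "W.span S" "?V\<lparr>carrier := W\<rparr>" by (rule spm)
  have sp0: "0\<^sub>m n n \<in> W.span S"
    and spadd: "X \<in> W.span S \<Longrightarrow> Y \<in> W.span S \<Longrightarrow> X + Y \<in> W.span S"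
    and spsm: "X \<in> W.span S \<Longrightarrow> c \<cdot>\<^sub>m X \<in> W.span S" for X Y c
    using sp.zero_closed sp.m_closed[of X Y] sp.smult_closed[of c X] by (simp_all add: module_mat_simps)
  have Ssp: "S \<subseteq> W.span S" using SW by (intro W.in_own_span) simp
  have "X \<in> W.span S" if "s \<le> n * n" "X \<in> flag n W s" for s X
    using that
  proof (induction arbitrary: X rule: inc_induct)
    case base
    then have "X = 0\<^sub>m n n" using Wc(1) by (intro eq_zero_mat_if_entries) (auto simp: flag_def)
    then show ?case using sp0 by simp
  next
    case (step s)
    have XW: "X \<in> W" and X0: "\<And>q. q < s \<Longrightarrow> entry n X q = 0" using step by (auto simp: flag_def)
    show ?case
    proof (cases "s \<in> pivots n W")
      case False
      then have "entry n X s = 0" using step by (auto simp: pivots_def)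
      then have "X \<in> flag n W (Suc s)" using XW X0 by (auto simp: flag_def less_Suc_eq)
      then show ?thesis by (rule step.IH)
    next
      case True
      define c where "c = entry n X s / entry n (w s) s"
      have ws: "w s \<in> W" "\<And>q. q < s \<Longrightarrow> entry n (w s) q = 0" "entry n (w s) s \<noteq> 0"
        using w[OF True] by (auto simp: flag_def)
      have car: "X \<in> carrier_mat n n" "w s \<in> carrier_mat n n" using XW ws Wc(1) by auto
      define Y where "Y = X + (- c) \<cdot>\<^sub>m w s"
      have "entry n Y q = entry n X q - c * entry n (w s) q" if "q \<le> s" for q
        using that car step unfolding Y_def by (subst entry_add) (auto simp: entry_smult)
      then have "Y \<in> flag n W (Suc s)"
        using X0 ws XW Wc by (auto simp: flag_def less_Suc_eq c_def Y_def)
      then have "Y + c \<cdot>\<^sub>m w s \<in> W.span S"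
        using step.IH spadd spsm Ssp True by (auto simp: S_def)
      moreover have "Y + c \<cdot>\<^sub>m w s = X" using car unfolding Y_def by (intro eq_matI) auto
      ultimately show ?thesis by simp
    qed
  qed
  from this[of 0] have "W \<subseteq> W.span S" by (auto simp: flag_def)
  then have "W.span S = W" using sp.subset by auto
  then have "W.dim \<le> card S" using finp SW by (intro W.gen_ge_dim) (auto simp: S_def)
  also have "\<dots> \<le> card (pivots n W)" unfolding S_def by (rule card_image_le[OF finp])
  finally show ?thesis by (simp add: subspace_dim_def)
qed

text \<open>The numbering of positions continues from one component to the next, so that the flags of the
  \<open>r\<close> factors are concatenated into one.\<close>

definition tuple_flag :: "nat \<Rightarrow> nat \<Rightarrow> 'k::zero mat set \<Rightarrow> nat \<Rightarrow> 'k mat list set" where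
  "tuple_flag r n W u = {xs \<in> mat_tuples r n. set xs \<subseteq> W \<and>
     (\<forall>t<r. \<forall>q<n*n. t * (n * n) + q < u \<longrightarrow> entry n (xs ! t) q = 0)}"

lemma closedin_tuple_flag:
  fixes W :: "'k::field mat set"
  assumes "closedin (zariski r n) {xs \<in> mat_tuples r n. set xs \<subseteq> W}"
  shows "closedin (zariski r n) (tuple_flag r n W u)"
proof -
  obtain F where F: "F \<subseteq> poly_funs r n"
    "{xs \<in> mat_tuples r n. set xs \<subseteq> W} = {x \<in> mat_tuples r n. \<forall>f\<in>F. f x = 0}"
    using assms unfolding closedin_zariski by blast
  define G :: "('k mat list \<Rightarrow> 'k) set" where
    "G = {\<lambda>xs. entry n (xs ! t) q | t q. t < r \<and> q < n * n \<and> t * (n * n) + q < u}"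
  have "G \<subseteq> poly_funs r n"
    using entry_bounds by (auto simp: G_def entry_def intro!: poly_funs.coord)
  moreover have "tuple_flag r n W u = {xs \<in> mat_tuples r n. set xs \<subseteq> W} \<inter>
      {xs \<in> mat_tuples r n. \<forall>g\<in>G. g xs = 0}"
    by (auto simp: tuple_flag_def G_def)
  ultimately show ?thesis
    unfolding closedin_zariski F(2) using F(1) by (intro exI[of _ "F \<union> G"]) auto
qed

lemma line_in_tuple_flag:
  fixes W :: "'k::field mat set"
  assumes W: "submodule class_ring W (module_mat TYPE('k) n n)"
    and xs: "xs \<in> tuple_flag r n W u" and ys: "ys \<in> tuple_flag r n W u"
  shows "line xs ys c \<in> tuple_flag r n W u"
proof -
  note Wc = subspace_closed[OF W]
  have m: "xs \<in> mat_tuples r n" "ys \<in> mat_tuples r n" using xs ys by (auto simp: tuple_flag_def)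
  have len: "length xs = r" "length ys = r" using m by (auto simp: mat_tuples_def)
  have el: "line xs ys c ! t \<in> W" if "t < r" for t
  proof -
    have W': "xs ! t \<in> W" "ys ! t \<in> W" using xs ys that len by (auto simp: tuple_flag_def)
    then have car: "xs ! t \<in> carrier_mat n n" "ys ! t \<in> carrier_mat n n" using Wc(1) by auto
    have "line xs ys c ! t = xs ! t + c \<cdot>\<^sub>m (ys ! t + (- 1) \<cdot>\<^sub>m xs ! t)"
      using that len car by (auto simp: line_def intro!: eq_matI)
    then show ?thesis using W' Wc by simp
  qed
  have ll: "length (line xs ys c) = r" using len by (simp add: line_def)
  have "set (line xs ys c) \<subseteq> W" using el ll by (metis in_set_conv_nth subsetI)
  then show ?thesis
    using xs ys ll Wc(1) line_nth_index[OF m] entry_bounds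
    unfolding tuple_flag_def by (auto simp: mat_tuples_def entry_def)
qed

text \<open>A pivot of \<open>W\<close> is a drop of the tuple flag in each of the \<open>r\<close> components: put a matrix with that
  leading position into the component and zero into all others.\<close>

lemma tuple_flag_strict:
  fixes W :: "'k::field mat set"
  assumes W: "submodule class_ring W (module_mat TYPE('k) n n)"
    and t: "t < r" and q: "q \<in> pivots n W"
  shows "tuple_flag r n W (Suc (t * (n * n) + q)) \<noteq> tuple_flag r n W (t * (n * n) + q)"
proof -
  note Wc = subspace_closed[OF W]
  obtain X where X: "X \<in> W" "\<And>s. s < q \<Longrightarrow> entry n X s = 0" "entry n X q \<noteq> 0" and qn: "q < n * n"
    using q by (auto simp: pivots_def flag_def)
  define xs where "xs = (replicate r (0\<^sub>m n n))[t := X]"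
  have nth: "xs ! s = (if s = t then X else 0\<^sub>m n n)" if "s < r" for s
    using that by (simp add: xs_def nth_list_update)
  have sW: "set xs \<subseteq> W" unfolding xs_def using X(1) Wc(2)
    by (metis insert_subset set_replicate_conv_if set_update_subset_insert subset_trans empty_subsetI)
  have mt: "xs \<in> mat_tuples r n" using sW Wc(1) by (auto simp: mat_tuples_def xs_def)
  have "xs \<in> tuple_flag r n W (t * (n * n) + q)"
    using sW mt X(2) nth entry_zero by (auto simp: tuple_flag_def)
  moreover have "xs \<notin> tuple_flag r n W (Suc (t * (n * n) + q))"
    using t qn X(3) nth[OF t] by (auto simp: tuple_flag_def)
  ultimately show ?thesis by blast
qed

text \<open>The pairs of a component \<open>t\<close> and a pivot \<open>q\<close> inject into the steps at which the tuple flag drops,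
  by Euclidean division by \<open>n\<^sup>2\<close>.\<close>

theorem variety_dim_ge_subspace_tuples:
  fixes W :: "'k::field mat set"
  assumes inf: "infinite (UNIV :: 'k set)"
    and W: "submodule class_ring W (module_mat TYPE('k) n n)"
    and cl: "closedin (zariski r n) {xs \<in> mat_tuples r n. set xs \<subseteq> W}"
    and sub: "{xs \<in> mat_tuples r n. set xs \<subseteq> W} \<subseteq> V"
  shows "enat (r * subspace_dim n W) \<le> variety_dim r n V"
proof -
  let ?T = "subtopology (zariski r n) V" and ?Z = "tuple_flag r n W" and ?M = "r * (n * n)"
  let ?h = "\<lambda>(t, q). t * (n * n) + q"
  note Wc = subspace_closed[OF W]
  have ZV: "?Z u \<subseteq> V" for u using sub by (auto simp: tuple_flag_def)
  have Zt: "?Z u \<subseteq> mat_tuples r n" for u by (auto simp: tuple_flag_def)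
  have "replicate r (0\<^sub>m n n) \<in> ?Z u" for u
    using Wc(2) by (auto simp: tuple_flag_def mat_tuples_def entry_zero)
  then have irr: "irreducible_in ?T (?Z u)" for u
    by (intro irreducible_in_subtopology_zariski inf ZV Zt line_in_tuple_flag[OF W]) auto
  have clo: "closedin ?T (?Z u)" for u
    using closedin_tuple_flag[OF cl, of u] ZV[of u] closedin_subset_topspace by (metis closedin_subtopology inf.absorb1)
  have "r * card (pivots n W) = card ({..<r} \<times> pivots n W)" by (simp add: card_cartesian_product)
  also have "\<dots> = card (?h ` ({..<r} \<times> pivots n W))"
  proof (rule card_image[symmetric], rule inj_onI)
    fix x y assume "x \<in> {..<r} \<times> pivots n W" "y \<in> {..<r} \<times> pivots n W" "?h x = ?h y"
    then obtain t q t' q' where *: "x = (t, q)" "y = (t', q')" "q < n * n" "q' < n * n"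
      "t * (n * n) + q = t' * (n * n) + q'" by (auto simp: pivots_def)
    have "(a * N + b) div N = a" if "b < N" for a b N :: nat
      using that by simp
    from this[OF *(3), of t] this[OF *(4), of t'] have "t = t'" using *(5) by simp
    then show "x = y" using * by auto
  qed
  also have "\<dots> \<le> card {u. u < ?M \<and> ?Z (Suc u) \<noteq> ?Z u}"
  proof (rule card_mono)
    have bound: "t * (n * n) + q < ?M" if "t < r" "q < n * n" for t q
    proof -
      have "t * (n * n) + q < Suc t * (n * n)" using that by simp
      also have "\<dots> \<le> ?M" using that by (intro mult_le_mono1) simp
      finally show ?thesis .
    qed
    show "?h ` ({..<r} \<times> pivots n W) \<subseteq> {u. u < ?M \<and> ?Z (Suc u) \<noteq> ?Z u}"
    proof
      fix u assume "u \<in> ?h ` ({..<r} \<times> pivots n W)"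
      then obtain t q where u: "u = t * (n * n) + q" "t < r" "q \<in> pivots n W" by auto
      show "u \<in> {u. u < ?M \<and> ?Z (Suc u) \<noteq> ?Z u}"
        using bound[OF u(2) pivots_less[OF u(3)]] tuple_flag_strict[OF W u(2,3)] u(1) by blast
    qed
  qed simp
  finally have "r * card (pivots n W) \<le> card {u. u < ?M \<and> ?Z (Suc u) \<noteq> ?Z u}" .
  then have "r * subspace_dim n W \<le> card {u. u < ?M \<and> ?Z (Suc u) \<noteq> ?Z u}"
    using mult_le_mono2[OF subspace_dim_le_card_pivots[OF W], of r] by (rule le_trans[rotated])
  also have "enat \<dots> \<le> krull_dim ?T"
    by (rule krull_dim_ge_strict_steps) (use irr clo in \<open>auto simp: tuple_flag_def\<close>)
  finally show ?thesis by (simp add: variety_dim_def)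
qed

section \<open>The corner spaces\<close>

text \<open>A common shape for all corner spaces: \<open>e i j = 0\<close> forces an entry to vanish,
  \<open>e i j = 1\<close> with \<open>\<sigma> i j = (i, j)\<close> leaves it free, and \<open>e i j = \<plusminus>1\<close> with \<open>\<sigma>\<close> the reflection over the
  anti-diagonal expresses (skew) symmetry.\<close>

definition entry_relations ::
  "nat \<Rightarrow> (nat \<Rightarrow> nat \<Rightarrow> 'k) \<Rightarrow> (nat \<Rightarrow> nat \<Rightarrow> nat \<times> nat) \<Rightarrow> 'k::semiring_0 mat set" where
  "entry_relations n e \<sigma> = {X \<in> carrier_mat n n. \<forall>i<n. \<forall>j<n. X $$ (i, j) = e i j * X $$ \<sigma> i j}"

lemma entry_relations_carrier: "X \<in> entry_relations n e \<sigma> \<Longrightarrow> X \<in> carrier_mat n n"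
  unfolding entry_relations_def by blast

lemma entry_relationsD:
  "X \<in> entry_relations n e \<sigma> \<Longrightarrow> i < n \<Longrightarrow> j < n \<Longrightarrow> X $$ (i, j) = e i j * X $$ \<sigma> i j"
  unfolding entry_relations_def by blast

lemma entry_relations_zero:
  "X \<in> entry_relations n e \<sigma> \<Longrightarrow> i < n \<Longrightarrow> j < n \<Longrightarrow> e i j = 0 \<Longrightarrow> X $$ (i, j) = 0"
  using entry_relationsD[of X n e \<sigma> i j] by (metis mult_zero_left)

lemma submodule_entry_relations:
  fixes e :: "nat \<Rightarrow> nat \<Rightarrow> 'k::field"
  assumes \<sigma>: "\<And>i j. i < n \<Longrightarrow> j < n \<Longrightarrow> \<sigma> i j \<in> {..<n} \<times> {..<n}"
  shows "submodule class_ring (entry_relations n e \<sigma>) (module_mat TYPE('k) n n)"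
proof -
  interpret V: vectorspace class_ring "module_mat TYPE('k) n n" by (rule matrix_vs)
  have \<sigma>': "fst (\<sigma> i j) < n" "snd (\<sigma> i j) < n" if "i < n" "j < n" for i j
    using \<sigma>[OF that] by auto
  have add: "(X + Y) $$ \<sigma> i j = X $$ \<sigma> i j + Y $$ \<sigma> i j"
    and smult: "(c \<cdot>\<^sub>m X) $$ \<sigma> i j = c * X $$ \<sigma> i j"
    and zero: "0\<^sub>m n n $$ \<sigma> i j = (0 :: 'k)"
    if "X \<in> carrier_mat n n" "Y \<in> carrier_mat n n" "i < n" "j < n" for X Y :: "'k mat" and c i j
    using \<sigma>'[OF that(3,4)] that(1,2) by (cases "\<sigma> i j"; simp)+
  show ?thesis
    by (intro submodule.intro V.module_axioms)
       (auto simp: entry_relations_def module_mat_simps add smult zero[OF zero_carrier_mat zero_carrier_mat]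
          algebra_simps)
qed

lemma closedin_entry_relations:
  fixes e :: "nat \<Rightarrow> nat \<Rightarrow> 'k::field"
  assumes \<sigma>: "\<And>i j. i < n \<Longrightarrow> j < n \<Longrightarrow> \<sigma> i j \<in> {..<n} \<times> {..<n}"
  shows "closedin (zariski r n) {xs \<in> mat_tuples r n. set xs \<subseteq> entry_relations n e \<sigma>}"
proof -
  define f :: "nat \<times> nat \<times> nat \<Rightarrow> 'k mat list \<Rightarrow> 'k" where
    "f = (\<lambda>(t, i, j) xs. (xs ! t) $$ (i, j) + (- e i j) * (xs ! t) $$ \<sigma> i j)"
  define F where "F = f ` ({..<r} \<times> {..<n} \<times> {..<n})"
  have "f (t, i, j) \<in> poly_funs r n" if tij: "t < r" "i < n" "j < n" for t i j
  proof -
    obtain a b where ab: "\<sigma> i j = (a, b)" "a < n" "b < n" using \<sigma>[OF tij(2,3)] by blast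
    show ?thesis
      unfolding f_def prod.case ab(1)
      by (intro poly_funs.add poly_funs.mult poly_funs.const poly_funs.coord tij ab(2,3))
  qed
  then have "F \<subseteq> poly_funs r n" by (auto simp: F_def)
  moreover have "set xs \<subseteq> entry_relations n e \<sigma> \<longleftrightarrow> (\<forall>g\<in>F. g xs = 0)"
    if xs: "xs \<in> mat_tuples r n" for xs
  proof -
    have len: "length xs = r" and car: "\<And>t. t < r \<Longrightarrow> xs ! t \<in> carrier_mat n n"
      using xs by (auto simp: mat_tuples_def)
    have "set xs \<subseteq> entry_relations n e \<sigma> \<longleftrightarrow> (\<forall>t<r. xs ! t \<in> entry_relations n e \<sigma>)"
      using len by (auto simp: subset_iff in_set_conv_nth)
    also have "\<dots> \<longleftrightarrow> (\<forall>g\<in>F. g xs = 0)"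
      using car by (auto simp: entry_relations_def F_def f_def)
    finally show ?thesis .
  qed
  ultimately show ?thesis unfolding closedin_zariski by (intro exI[of _ F]) auto
qed

text \<open>The corner is given by its first \<open>a\<close> rows and the columns from \<open>c\<close> on; when \<open>a \<le> c\<close> it lies
  strictly above the diagonal.\<close>

definition in_corner :: "nat \<Rightarrow> nat \<Rightarrow> nat \<Rightarrow> nat \<Rightarrow> bool" where
  "in_corner a c i j \<longleftrightarrow> i < a \<and> c \<le> j"

lemma corner_index:
  assumes "m \<in> carrier_mat a b" "a \<le> n" "b \<le> n" "i < n" "j < n"
  shows "corner n m $$ (i, j) = (if in_corner a (n - b) i j then m $$ (i, j - (n - b)) else 0)"
  using assms by (auto simp: corner_def in_corner_def)

lemma corner_carrier:
  "m \<in> carrier_mat a b \<Longrightarrow> a \<le> n \<Longrightarrow> b \<le> n \<Longrightarrow> corner n m \<in> carrier_mat n n"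
  by (auto simp: corner_def)

lemma corner_image_eq:
  assumes "a \<le> n" "b \<le> n"
  shows "corner n ` {m \<in> carrier_mat a b. P m} =
    {X \<in> carrier_mat n n. (\<forall>i<n. \<forall>j<n. \<not> in_corner a (n - b) i j \<longrightarrow> X $$ (i, j) = 0) \<and>
       P (mat a b (\<lambda>(i, j). X $$ (i, n - b + j)))}"
    (is "?A = ?B")
proof (intro equalityI subsetI)
  fix X assume "X \<in> ?A"
  then obtain m where m: "m \<in> carrier_mat a b" "P m" "X = corner n m" by auto
  have "mat a b (\<lambda>(i, j). X $$ (i, n - b + j)) = m"
    by (rule eq_matI) (use m assms in \<open>auto simp: corner_index in_corner_def\<close>)
  then show "X \<in> ?B"
    using m assms corner_index[OF m(1) assms] corner_carrier[OF m(1) assms] by auto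
next
  fix X assume X: "X \<in> ?B"
  let ?m = "mat a b (\<lambda>(i, j). X $$ (i, n - b + j))"
  have m: "?m \<in> carrier_mat a b" by simp
  have "X = corner n ?m"
  proof (rule eq_matI)
    have "corner n ?m \<in> carrier_mat n n" by (rule corner_carrier[OF m assms])
    then have dims: "dim_row (corner n ?m) = n" "dim_col (corner n ?m) = n" by auto
    show "dim_row X = dim_row (corner n ?m)" "dim_col X = dim_col (corner n ?m)"
      using X dims by auto
    fix i j assume "i < dim_row (corner n ?m)" "j < dim_col (corner n ?m)"
    then have ij: "i < n" "j < n" using dims by auto
    show "X $$ (i, j) = corner n ?m $$ (i, j)"
      unfolding corner_index[OF m assms ij] using X ij assms by (auto simp: in_corner_def)
  qed
  moreover have "?m \<in> {m \<in> carrier_mat a b. P m}" using X by simp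
  ultimately show "X \<in> ?A" by (rule image_eqI)
qed

lemma corner_space_SL:
  "(corner_space (SL n) :: 'k::comm_ring_1 mat set) =
    entry_relations n (\<lambda>i j. if in_corner (n div 2) (n div 2) i j then 1 else 0) (\<lambda>i j. (i, j))"
proof -
  have "(corner_space (SL n) :: 'k mat set) = corner n ` {m \<in> carrier_mat (n div 2) (n - n div 2). True}"
    by (simp add: corner_space_def)
  also have "\<dots> = {X \<in> carrier_mat n n. \<forall>i<n. \<forall>j<n. \<not> in_corner (n div 2) (n div 2) i j \<longrightarrow> X $$ (i, j) = 0}"
    by (subst corner_image_eq) auto
  also have "\<dots> = entry_relations n (\<lambda>i j. if in_corner (n div 2) (n div 2) i j then 1 else 0) (\<lambda>i j. (i, j))"
  proof -
    have "(\<not> b \<longrightarrow> x = 0) \<longleftrightarrow> x = (if b then 1 else 0) * x" for b and x :: 'k by simp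
    then show ?thesis by (simp only: entry_relations_def)
  qed
  finally show ?thesis .
qed

text \<open>The anti-diagonal of a square block in the upper right corner is part of the anti-diagonal of
  the whole matrix, so reflecting the block agrees with reflecting the matrix. The factor
  \<open>\<epsilon> = \<plusminus>1\<close> covers the symplectic and the orthogonal families together.\<close>

lemma corner_reflected_image_eq:
  fixes \<epsilon> :: "'k::comm_ring_1"
  assumes "2 * l \<le> n"
  shows "corner n ` {m \<in> carrier_mat l l. m = \<epsilon> \<cdot>\<^sub>m reflect m} =
    entry_relations n (\<lambda>i j. if in_corner l (n - l) i j then \<epsilon> else 0) (\<lambda>i j. (n - 1 - j, n - 1 - i))"
    (is "_ = ?R")
proof -
  have ln: "l \<le> n" using assms by simp
  have blk: "mat l l (\<lambda>(i, j). X $$ (i, n - l + j)) = \<epsilon> \<cdot>\<^sub>m reflect (mat l l (\<lambda>(i, j). X $$ (i, n - l + j))) \<longleftrightarrow>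
      (\<forall>i<n. \<forall>j<n. in_corner l (n - l) i j \<longrightarrow> X $$ (i, j) = \<epsilon> * X $$ (n - 1 - j, n - 1 - i))"
    (is "?l \<longleftrightarrow> ?r") if "X \<in> carrier_mat n n" for X :: "'k mat"
  proof -
    have "?l \<longleftrightarrow> (\<forall>i<l. \<forall>j<l. X $$ (i, n - l + j) = \<epsilon> * X $$ (l - 1 - j, n - l + (l - 1 - i)))"
      by (auto simp: mat_eq_iff reflect_def)
    also have "\<dots> \<longleftrightarrow> ?r"
    proof (intro iffI allI impI)
      fix i j assume *: "\<forall>i<l. \<forall>j<l. X $$ (i, n - l + j) = \<epsilon> * X $$ (l - 1 - j, n - l + (l - 1 - i))"
        and ij: "i < n" "j < n" "in_corner l (n - l) i j"
      then have "i < l" "j - (n - l) < l" "n - l + (j - (n - l)) = j"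
        "l - 1 - (j - (n - l)) = n - 1 - j" "n - l + (l - 1 - i) = n - 1 - i"
        using ln by (auto simp: in_corner_def)
      then show "X $$ (i, j) = \<epsilon> * X $$ (n - 1 - j, n - 1 - i)" using * by metis
    next
      fix i j assume *: ?r and ij: "i < l" "j < l"
      then have "i < n" "n - l + j < n" "in_corner l (n - l) i (n - l + j)"
        "n - 1 - (n - l + j) = l - 1 - j" "n - l + (l - 1 - i) = n - 1 - i"
        using ln by (auto simp: in_corner_def)
      then show "X $$ (i, n - l + j) = \<epsilon> * X $$ (l - 1 - j, n - l + (l - 1 - i))" using * by metis
    qed
    finally show ?thesis .
  qed
  have "corner n ` {m \<in> carrier_mat l l. m = \<epsilon> \<cdot>\<^sub>m reflect m} =
    {X \<in> carrier_mat n n. (\<forall>i<n. \<forall>j<n. \<not> in_corner l (n - l) i j \<longrightarrow> X $$ (i, j) = 0) \<and>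
      (\<forall>i<n. \<forall>j<n. in_corner l (n - l) i j \<longrightarrow> X $$ (i, j) = \<epsilon> * X $$ (n - 1 - j, n - 1 - i))}"
    unfolding corner_image_eq[OF ln ln] using blk by (intro Collect_cong) blast
  also have "\<dots> = ?R"
  proof -
    have "x = (if b then \<epsilon> else 0) * y \<longleftrightarrow> (\<not> b \<longrightarrow> x = 0) \<and> (b \<longrightarrow> x = \<epsilon> * y)" for b x y by simp
    then show ?thesis unfolding entry_relations_def by (intro Collect_cong) (simp only: , blast)
  qed
  finally show ?thesis .
qed

text \<open>In \<open>X\<^bsub>ik\<^esub> Y\<^bsub>kj\<^esub>\<close> the first factor needs \<open>k \<ge> c\<close> and the second \<open>k < a\<close> in order not to
  vanish.\<close>

lemma corner_mult_zero:
  assumes X: "X \<in> entry_relations n e \<sigma>" and Y: "Y \<in> entry_relations n e \<sigma>"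
    and e: "\<And>i j. \<not> in_corner a c i j \<Longrightarrow> e i j = 0" and "a \<le> c"
  shows "X * Y = 0\<^sub>m n n"
proof (rule eq_matI)
  have car: "X \<in> carrier_mat n n" "Y \<in> carrier_mat n n" using X Y by (auto dest: entry_relations_carrier)
  then show "dim_row (X * Y) = dim_row (0\<^sub>m n n)" "dim_col (X * Y) = dim_col (0\<^sub>m n n)" by auto
  fix i j assume "i < dim_row (0\<^sub>m n n)" "j < dim_col (0\<^sub>m n n)"
  then have ij: "i < n" "j < n" by auto
  have z: "Z $$ (u, v) = 0" if "Z \<in> entry_relations n e \<sigma>" "\<not> in_corner a c u v" "u < n" "v < n" for Z u v
    using that e[of u v] entry_relations_zero by blast
  have "X $$ (i, k) * Y $$ (k, j) = 0" if "k < n" for k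
  proof (cases "c \<le> k")
    case True
    then have "Y $$ (k, j) = 0" using z[OF Y] that ij \<open>a \<le> c\<close> by (simp add: in_corner_def)
    then show ?thesis by simp
  next
    case False
    then have "X $$ (i, k) = 0" using z[OF X] that ij by (simp add: in_corner_def)
    then show ?thesis by simp
  qed
  then have "(X * Y) $$ (i, j) = 0" using car ij by (auto simp: scalar_prod_def)
  then show "(X * Y) $$ (i, j) = 0\<^sub>m n n $$ (i, j)" using ij by simp
qed

lemma pow_mat_square_zero:
  assumes X: "X \<in> carrier_mat n n" and sq: "X * X = 0\<^sub>m n n" and "2 \<le> p"
  shows "X ^\<^sub>m p = 0\<^sub>m n n"
  using \<open>2 \<le> p\<close>
proof (induction p rule: dec_induct)
  case base
  then show ?case using X sq by (simp add: numeral_2_eq_2)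
next
  case (step p)
  then show ?case using X by simp
qed

text \<open>The three forms have nonzero entries on the anti-diagonal only, so each entry of
  \<open>X\<^sup>t S + S X\<close> has just two terms.\<close>

lemma antidiagonal_preserving:
  fixes X :: "'k::comm_ring_1 mat"
  assumes S: "S \<in> carrier_mat n n"
    "\<And>i j. i < n \<Longrightarrow> j < n \<Longrightarrow> S $$ (i, j) = (if i + j + 1 = n then s i else 0)"
    and X: "X \<in> carrier_mat n n"
    "\<And>i j. i < n \<Longrightarrow> j < n \<Longrightarrow> s (n - 1 - j) * X $$ (n - 1 - j, i) + s i * X $$ (n - 1 - i, j) = 0"
  shows "X \<in> preserving n S"
proof -
  have "transpose_mat X * S + S * X = 0\<^sub>m n n"
  proof (rule eq_matI)
    fix i j assume "i < dim_row (0\<^sub>m n n)" "j < dim_col (0\<^sub>m n n)"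
    then have ij: "i < n" "j < n" by auto
    have "(transpose_mat X * S) $$ (i, j) = (\<Sum>k<n. X $$ (k, i) * S $$ (k, j))"
      using S(1) X(1) ij by (auto simp: scalar_prod_def atLeast0LessThan)
    also have "\<dots> = (\<Sum>k<n. if k = n - 1 - j then X $$ (k, i) * s k else 0)"
      using ij S(2) by (intro sum.cong) auto
    also have "\<dots> = s (n - 1 - j) * X $$ (n - 1 - j, i)" using ij by (simp add: mult.commute)
    finally have 1: "(transpose_mat X * S) $$ (i, j) = s (n - 1 - j) * X $$ (n - 1 - j, i)" .
    have "(S * X) $$ (i, j) = (\<Sum>k<n. S $$ (i, k) * X $$ (k, j))"
      using S(1) X(1) ij by (auto simp: scalar_prod_def atLeast0LessThan)
    also have "\<dots> = (\<Sum>k<n. if k = n - 1 - i then s i * X $$ (k, j) else 0)"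
      using ij S(2) by (intro sum.cong) auto
    also have "\<dots> = s i * X $$ (n - 1 - i, j)" using ij by simp
    finally have 2: "(S * X) $$ (i, j) = s i * X $$ (n - 1 - i, j)" .
    show "(transpose_mat X * S + S * X) $$ (i, j) = 0\<^sub>m n n $$ (i, j)"
      using 1 2 X(2)[OF ij] S(1) X(1) ij by simp
  qed (use S X in auto)
  then show ?thesis using X(1) by (simp add: preserving_def)
qed

text \<open>The two terms are entries of \<open>X\<close> at reflected positions. Either both lie outside the corner,
  or the relation \<open>\<epsilon>\<close> between them cancels against the signs of the form, for which
  \<open>\<epsilon> s\<^sub>i + s\<^sub>j = 0\<close> whenever \<open>i\<close> indexes one of the first and \<open>j\<close> one of the last \<open>l\<close> rows.\<close>

lemma reflected_corner_preserving:
  fixes \<epsilon> :: "'k::comm_ring_1"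
  assumes S: "S \<in> carrier_mat n n"
    "\<And>i j. i < n \<Longrightarrow> j < n \<Longrightarrow> S $$ (i, j) = (if i + j + 1 = n then s i else 0)"
    and s: "\<And>i j. i < l \<Longrightarrow> n - l \<le> j \<Longrightarrow> j < n \<Longrightarrow> \<epsilon> * s i + s j = 0"
    and X: "X \<in> entry_relations n (\<lambda>i j. if in_corner l (n - l) i j then \<epsilon> else 0)
      (\<lambda>i j. (n - 1 - j, n - 1 - i))" and l: "2 * l \<le> n"
  shows "X \<in> preserving n S"
proof (rule antidiagonal_preserving[OF S])
  show "X \<in> carrier_mat n n" using X by (rule entry_relations_carrier)
  have rel: "X $$ (i, j) = (if in_corner l (n - l) i j then \<epsilon> * X $$ (n - 1 - j, n - 1 - i) else 0)"
    if "i < n" "j < n" for i j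
    by (subst entry_relationsD[OF X that]) simp
  fix i j assume ij: "i < n" "j < n"
  show "s (n - 1 - j) * X $$ (n - 1 - j, i) + s i * X $$ (n - 1 - i, j) = 0"
  proof (cases "in_corner l (n - l) (n - 1 - j) i")
    case True
    then have "s (n - 1 - j) * X $$ (n - 1 - j, i) + s i * X $$ (n - 1 - i, j) =
        (\<epsilon> * s (n - 1 - j) + s i) * X $$ (n - 1 - i, j)"
      using ij rel[of "n - 1 - j" i] by (simp add: algebra_simps)
    also have "\<dots> = 0" using s[of "n - 1 - j" i] True ij by (simp add: in_corner_def)
    finally show ?thesis .
  next
    case False
    then have "\<not> in_corner l (n - l) (n - 1 - i) j" using ij l by (auto simp: in_corner_def)
    then show ?thesis using False ij rel[of "n - 1 - j" i] rel[of "n - 1 - i" j] by simp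
  qed
qed

lemma form_index:
  shows "i < 2 * l \<Longrightarrow> j < 2 * l \<Longrightarrow>
      sp_form l $$ (i, j) = (if i + j + 1 = 2 * l then if i < l then 1 else - 1 else 0)"
    and "i < 2 * l \<Longrightarrow> j < 2 * l \<Longrightarrow>
      so_even_form l $$ (i, j) = (if i + j + 1 = 2 * l then 1 else 0)"
    and "i < 2 * l + 1 \<Longrightarrow> j < 2 * l + 1 \<Longrightarrow>
      so_odd_form l $$ (i, j) = (if i + j + 1 = 2 * l + 1 then 1 else 0)"
  by (auto simp: sp_form_def so_even_form_def so_odd_form_def antidiag_def)

lemma form_carrier:
  "sp_form l \<in> carrier_mat (2 * l) (2 * l)" "so_even_form l \<in> carrier_mat (2 * l) (2 * l)"
  "so_odd_form l \<in> carrier_mat (2 * l + 1) (2 * l + 1)"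
  by (auto simp: sp_form_def so_even_form_def so_odd_form_def antidiag_def)

lemma smult_reflect:
  fixes m :: "'k::comm_ring_1 mat"
  shows "1 \<cdot>\<^sub>m reflect m = reflect m" "(- 1) \<cdot>\<^sub>m reflect m = - reflect m"
  by (auto intro!: eq_matI)

text \<open>This hands the four families over to the uniform argument. The diagonal of a corner matrix
  vanishes, which gives the trace condition of the special linear and the central entry condition
  of the odd orthogonal family.\<close>

lemma corner_space_entry_relations:
  obtains e \<sigma> a c where
    "(corner_space L :: 'k::comm_ring_1 mat set) = entry_relations (msize L) e \<sigma>"
    "\<And>i j. i < msize L \<Longrightarrow> j < msize L \<Longrightarrow> \<sigma> i j \<in> {..<msize L} \<times> {..<msize L}"
    "\<And>i j. \<not> in_corner a c i j \<Longrightarrow> e i j = 0" "a \<le> c"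
    "(corner_space L :: 'k mat set) \<subseteq> lie_alg L"
proof (cases L)
  case (SL n)
  let ?e = "\<lambda>i j. if in_corner (n div 2) (n div 2) i j then 1 else (0 :: 'k)"
  have "X \<in> lie_alg L" if "X \<in> corner_space L" for X :: "'k mat"
  proof -
    have "X \<in> entry_relations n ?e (\<lambda>i j. (i, j))" using that unfolding SL corner_space_SL .
    then have "X \<in> carrier_mat n n" "\<forall>i<n. X $$ (i, i) = 0"
      by (auto simp: in_corner_def intro: entry_relations_carrier entry_relations_zero)
    then show ?thesis by (simp add: SL)
  qed
  then show thesis
    by (intro that[of ?e "\<lambda>i j. (i, j)" "n div 2" "n div 2"]) (auto simp: SL corner_space_SL)
next
  case (SP l)
  let ?e = "\<lambda>i j. if in_corner l (2 * l - l) i j then 1 else (0 :: 'k)"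
  let ?\<sigma> = "\<lambda>i j. (2 * l - 1 - j, 2 * l - 1 - i)"
  have eq: "(corner_space L :: 'k mat set) = entry_relations (2 * l) ?e ?\<sigma>"
    using corner_reflected_image_eq[of l "2 * l" "1 :: 'k"]
    by (simp add: SP corner_space_def smult_reflect)
  moreover have "X \<in> lie_alg L" if "X \<in> corner_space L" for X :: "'k mat"
  proof -
    have rel: "X \<in> entry_relations (2 * l) ?e ?\<sigma>" using that unfolding eq .
    show ?thesis
      unfolding SP lie_alg.simps
      by (rule reflected_corner_preserving[where s = "\<lambda>i. if i < l then 1 else - 1", OF form_carrier(1) _ _ rel])
        (simp_all add: form_index)
  qed
  ultimately show thesis by (intro that[of ?e ?\<sigma> l "2 * l - l"]) (auto simp: SP)
next
  case (SO_even l)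
  let ?e = "\<lambda>i j. if in_corner l (2 * l - l) i j then - 1 else (0 :: 'k)"
  let ?\<sigma> = "\<lambda>i j. (2 * l - 1 - j, 2 * l - 1 - i)"
  have eq: "(corner_space L :: 'k mat set) = entry_relations (2 * l) ?e ?\<sigma>"
    using corner_reflected_image_eq[of l "2 * l" "- 1 :: 'k"]
    by (simp add: SO_even corner_space_def smult_reflect)
  moreover have "X \<in> lie_alg L" if "X \<in> corner_space L" for X :: "'k mat"
  proof -
    have rel: "X \<in> entry_relations (2 * l) ?e ?\<sigma>" using that unfolding eq .
    show ?thesis
      unfolding SO_even lie_alg.simps
      by (rule reflected_corner_preserving[where s = "\<lambda>_. 1", OF form_carrier(2) _ _ rel])
        (simp_all add: form_index)
  qed
  ultimately show thesis by (intro that[of ?e ?\<sigma> l "2 * l - l"]) (auto simp: SO_even)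
next
  case (SO_odd l)
  let ?n = "2 * l + 1"
  let ?e = "\<lambda>i j. if in_corner l (?n - l) i j then - 1 else (0 :: 'k)"
  let ?\<sigma> = "\<lambda>i j. (?n - 1 - j, ?n - 1 - i)"
  have eq: "(corner_space L :: 'k mat set) = entry_relations ?n ?e ?\<sigma>"
    using corner_reflected_image_eq[of l ?n "- 1 :: 'k"]
    by (simp add: SO_odd corner_space_def smult_reflect)
  moreover have "X \<in> lie_alg L" if "X \<in> corner_space L" for X :: "'k mat"
  proof -
    have rel: "X \<in> entry_relations ?n ?e ?\<sigma>" using that unfolding eq .
    have "X \<in> preserving ?n (so_odd_form l)"
      by (rule reflected_corner_preserving[where s = "\<lambda>_. 1", OF form_carrier(3) _ _ rel])
        (simp_all add: form_index)
    moreover have "X $$ (l, l) = 0"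
      using rel by (rule entry_relations_zero) (auto simp: in_corner_def)
    ultimately show ?thesis by (simp add: SO_odd)
  qed
  ultimately show thesis by (intro that[of ?e ?\<sigma> l "?n - l"]) (auto simp: SO_odd)
qed

theorem corollary3p2p3:
  fixes L :: classical and p r :: nat
  assumes "prime p" and "CHAR('k::alg_closed_field) = p"
    and "proper L" and "1 \<le> r"
  shows "variety_dim r (msize L) (commuting_variety r (nilrad1 p L :: 'k mat set))
           \<ge> enat (r * subspace_dim (msize L) (corner_space L :: 'k mat set))"
proof -
  let ?n = "msize L" and ?W = "corner_space L :: 'k mat set"
  obtain e \<sigma> a c where W: "?W = entry_relations ?n e \<sigma>"
    and \<sigma>: "\<And>i j. i < ?n \<Longrightarrow> j < ?n \<Longrightarrow> \<sigma> i j \<in> {..<?n} \<times> {..<?n}"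
    and e: "\<And>i j. \<not> in_corner a c i j \<Longrightarrow> e i j = 0" and ac: "a \<le> c"
    and lie: "?W \<subseteq> lie_alg L"
    using corner_space_entry_relations[where 'k = 'k and L = L] by blast
  have mult0: "X * Y = 0\<^sub>m ?n ?n" if "X \<in> ?W" "Y \<in> ?W" for X Y
    using that unfolding W by (rule corner_mult_zero) (use e ac in auto)
  have car: "X \<in> carrier_mat ?n ?n" if "X \<in> ?W" for X
    using that unfolding W by (rule entry_relations_carrier)
  have upper: "X $$ (i, j) = 0" if "X \<in> ?W" "i < ?n" "j \<le> i" for X i j
    using that(1) unfolding W by (rule entry_relations_zero) (use that e ac in \<open>auto simp: in_corner_def\<close>)
  have "2 \<le> p" using \<open>prime p\<close> by (rule prime_ge_2_nat)
  then have "?W \<subseteq> nilrad1 p L"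
    using lie upper pow_mat_square_zero[OF car mult0]
    by (auto simp: nilrad1_def restricted_nullcone_def nilrad_def)
  moreover have "xs ! i * xs ! j - xs ! j * xs ! i = 0\<^sub>m (dim_row (xs ! i)) (dim_row (xs ! i))"
    if "set xs \<subseteq> ?W" "i < length xs" "j < length xs" for xs i j
  proof -
    have W2: "xs ! i \<in> ?W" "xs ! j \<in> ?W" using that by auto
    then have "dim_row (xs ! i) = ?n" using car by auto
    then show ?thesis by (simp add: mult0 W2)
  qed
  ultimately have "{xs \<in> mat_tuples r ?n. set xs \<subseteq> ?W} \<subseteq> commuting_variety r (nilrad1 p L)"
    by (auto simp: commuting_variety_def mat_tuples_def)
  then show ?thesis
    unfolding W
    by (intro variety_dim_ge_subspace_tuples infinite_alg_closed_field submodule_entry_relations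
        closedin_entry_relations \<sigma>)
qed

end
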